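(* Let $\mathcal{H}$ be an infinite-dimensional real separable Hilbert space and let $T$ be a positive invertible operator on $\mathcal{H}\oplus\mathcal{H}$ such that $T-\alpha I$ is compact for some $\alpha>0$. Let ${\lambda_1^R}^\downarrow(T)\ge{\lambda_2^R}^\downarrow(T)\ge\cdots$ be the eigenvalues of $T$ lying strictly to the right of $\alpha$, arranged in decreasing order, and ${\lambda_1^L}^\uparrow(T)\le{\lambda_2^L}^\uparrow(T)\le\cdots$ the eigenvalues of $T$ lying strictly to the left of $\alpha$, arranged in increasing order. Let ${d_1^R}^\downarrow(T)\ge{d_2^R}^\downarrow(T)\ge\cdots$ be the symplectic eigenvalues of $T$ lying strictly to the right of $\alpha$, arranged in decreasing order, and ${d_1^L}^\uparrow(T)\le{d_2^L}^\uparrow(T)\le\cdots$ the symplectic eigenvalues of $T$ lying strictly to the left of $\alpha$, arranged in increasing order (all counted with multiplicity). Let $s_R,s_L\in\{0,1,2,\dots\}\cup\{\infty\}$ be the numbers of symplectic eigenvalues of $T$ lying strictly to the right and strictly to the left of $\alpha$, respectively. Then 1. ${d_j^R}^\downarrow(T)\le{\lambda_j^R}^\downarrow(T)$ for $j=1,2,\dots,s_R$; 2. ${\lambda_j^L}^\uparrow(T)\le{d_j^L}^\uparrow(T)$ for $j=1,2,\dots,s_L$. (When $s_R=\infty$ or $s_L=\infty$, the corresponding inequality holds for all $j\ge 1$.)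
   Context: All operators are bounded and real linear. An operator $A$ on a real Hilbert space is positive if it is self-adjoint ($A=A^T$, with $A^T$ the transpose, i.e. the real adjoint) and $\langle Ax,x\rangle\ge 0$ for all $x$. The spectrum and eigenvalues of an operator $A$ on a real Hilbert space are those of its complexification $\hat A(x+iy)=Ax+iAy$. On $\mathcal{H}\oplus\mathcal{H}$ let $J=\begin{bmatrix}0&I\\-I&0\end{bmatrix}$. A bounded invertible operator $M$ on $\mathcal{H}\oplus\mathcal{H}$ is a symplectic transformation if $M^TJM=J$. By Williamson's normal form (known), for every positive invertible $T$ on $\mathcal{H}\oplus\mathcal{H}$ there are a positive invertible operator $D$ on $\mathcal{H}$ and a symplectic transformation $M$ with $T=M^T\begin{bmatrix}D&0\\0&D\end{bmatrix}M$, and $D$ is unique up to conjugation by an orthogonal transformation. The symplectic spectrum of $T$ is the spectrum of $D$, and the symplectic eigenvalues of $T$ are the eigenvalues of $D$ (with their multiplicities as eigenvalues of $D$). When $T-\alpha I$ is compact, the eigenvalues and the symplectic eigenvalues of $T$ different from $\alpha$ have finite multiplicity and are at most countably many, with $\alpha$ as their only possible accumulation point, so the stated arrangements are possible. Moreover the number of eigenvalues of $T$ strictly to the right (left) of $\alpha$ is at least $s_R$ (at least $s_L$), so the terms in the inequalities are defined. *)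

theory Defs
  imports "HOL-Analysis.Analysis" "HOL-Library.Extended_Nat"
begin

(* Operators on a real Hilbert space are plain functions with a bounded_linear assumption.
   The transpose is the library's adjoint; it is a choice operator, but every bounded linear
   operator on a Hilbert space has exactly one adjoint (Riesz), so it is well defined wherever
   it is used below.  The direct sum of H with itself is the product type with its componentwise
   inner product. *)

definition positive_operator :: "('a::real_inner \<Rightarrow> 'a) \<Rightarrow> bool" where
  "positive_operator A \<longleftrightarrow>
     bounded_linear A \<and> adjoint A = A \<and> (\<forall>x. inner (A x) x \<ge> 0)"

definition invertible_operator :: "('a::real_normed_vector \<Rightarrow> 'a) \<Rightarrow> bool" where
  "invertible_operator A \<longleftrightarrow>
     bounded_linear A \<and> (\<exists>B. bounded_linear B \<and> A \<circ> B = id \<and> B \<circ> A = id)"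

definition compact_operator :: "('a::real_normed_vector \<Rightarrow> 'a) \<Rightarrow> bool" where
  "compact_operator A \<longleftrightarrow>
     bounded_linear A \<and> (\<forall>S. bounded S \<longrightarrow> compact (closure (A ` S)))"

definition infinite_dimensional :: "'a::real_vector set \<Rightarrow> bool" where
  "infinite_dimensional V \<longleftrightarrow> \<not> (\<exists>B. finite B \<and> V \<subseteq> span B)"

(* Complexification: the pair (x, y) stands for x + i y. *)

definition cscale :: "complex \<Rightarrow> 'a::real_vector \<times> 'a \<Rightarrow> 'a \<times> 'a" where
  "cscale z = (\<lambda>(x, y). (Re z *\<^sub>R x - Im z *\<^sub>R y, Im z *\<^sub>R x + Re z *\<^sub>R y))"

global_interpretation complexification:
  vector_space "cscale :: complex \<Rightarrow> 'a::real_vector \<times> 'a \<Rightarrow> 'a \<times> 'a"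
  by unfold_locales (auto simp: cscale_def algebra_simps)

definition complexify :: "('a \<Rightarrow> 'a) \<Rightarrow> 'a \<times> 'a \<Rightarrow> 'a \<times> 'a" where
  "complexify A = (\<lambda>(x, y). (A x, A y))"

definition eigenspace :: "('a::real_vector \<Rightarrow> 'a) \<Rightarrow> complex \<Rightarrow> ('a \<times> 'a) set" where
  "eigenspace A z = {v. complexify A v = cscale z v}"

(* The complex dimension of the eigenspace; the case distinction is needed because the library's
   dim of an infinite-dimensional space is 0.  Thus z is an eigenvalue of A iff its multiplicity
   is nonzero.  Only self-adjoint operators are considered, so geometric and algebraic
   multiplicities coincide and all eigenvalues are real. *)

definition eigen_multiplicity :: "('a::real_vector \<Rightarrow> 'a) \<Rightarrow> complex \<Rightarrow> enat" where
  "eigen_multiplicity A z =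
     (if \<exists>B. finite B \<and> eigenspace A z \<subseteq> complexification.span B
      then enat (complexification.dim (eigenspace A z)) else \<infinity>)"

definition index_set :: "enat \<Rightarrow> nat set" where
  "index_set n = {j. 1 \<le> j \<and> enat j \<le> n}"

(* f 1 \<ge> f 2 \<ge> ... is the arrangement, n terms in all (n possibly infinite), of the eigenvalues
   of A strictly to the right of alpha, each repeated according to its multiplicity.
   Values of f outside the index set are irrelevant. *)

definition eigenvalues_right ::
    "('a::real_vector \<Rightarrow> 'a) \<Rightarrow> real \<Rightarrow> enat \<Rightarrow> (nat \<Rightarrow> real) \<Rightarrow> bool" where
  "eigenvalues_right A \<alpha> n f \<longleftrightarrow>
     (\<forall>j\<in>index_set n. f j > \<alpha>) \<and>
     (\<forall>i\<in>index_set n. \<forall>j\<in>index_set n. i \<le> j \<longrightarrow> f i \<ge> f j) \<and>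
     (\<forall>\<mu>>\<alpha>. finite {j \<in> index_set n. f j = \<mu>} \<and>
        enat (card {j \<in> index_set n. f j = \<mu>}) = eigen_multiplicity A (complex_of_real \<mu>))"

definition eigenvalues_left ::
    "('a::real_vector \<Rightarrow> 'a) \<Rightarrow> real \<Rightarrow> enat \<Rightarrow> (nat \<Rightarrow> real) \<Rightarrow> bool" where
  "eigenvalues_left A \<alpha> n f \<longleftrightarrow>
     (\<forall>j\<in>index_set n. f j < \<alpha>) \<and>
     (\<forall>i\<in>index_set n. \<forall>j\<in>index_set n. i \<le> j \<longrightarrow> f i \<le> f j) \<and>
     (\<forall>\<mu><\<alpha>. finite {j \<in> index_set n. f j = \<mu>} \<and>
        enat (card {j \<in> index_set n. f j = \<mu>}) = eigen_multiplicity A (complex_of_real \<mu>))"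

definition J_op :: "'a::real_vector \<times> 'a \<Rightarrow> 'a \<times> 'a" where
  "J_op = (\<lambda>(x, y). (y, - x))"

definition symplectic :: "('a::real_inner \<times> 'a \<Rightarrow> 'a \<times> 'a) \<Rightarrow> bool" where
  "symplectic M \<longleftrightarrow> invertible_operator M \<and> adjoint M \<circ> J_op \<circ> M = J_op"

definition williamson_form ::
    "('a::real_inner \<times> 'a \<Rightarrow> 'a \<times> 'a) \<Rightarrow> ('a \<Rightarrow> 'a) \<Rightarrow> bool" where
  "williamson_form T D \<longleftrightarrow>
     positive_operator D \<and> invertible_operator D \<and>
     (\<exists>M. symplectic M \<and> T = adjoint M \<circ> map_prod D D \<circ> M)"

(* The symplectic eigenvalues of T are the eigenvalues of D in Williamson's normal form.  D is
   unique up to orthogonal conjugation, so the choice of D does not matter. *)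

definition symplectic_eigenvalues_right ::
    "('a::real_inner \<times> 'a \<Rightarrow> 'a \<times> 'a) \<Rightarrow> real \<Rightarrow> enat \<Rightarrow> (nat \<Rightarrow> real) \<Rightarrow> bool" where
  "symplectic_eigenvalues_right T \<alpha> s d \<longleftrightarrow>
     (\<exists>D. williamson_form T D \<and> eigenvalues_right D \<alpha> s d)"

definition symplectic_eigenvalues_left ::
    "('a::real_inner \<times> 'a \<Rightarrow> 'a \<times> 'a) \<Rightarrow> real \<Rightarrow> enat \<Rightarrow> (nat \<Rightarrow> real) \<Rightarrow> bool" where
  "symplectic_eigenvalues_left T \<alpha> s d \<longleftrightarrow>
     (\<exists>D. williamson_form T D \<and> eigenvalues_left D \<alpha> s d)"

end

theory Submission
  imports Defs
begin

text \<open>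
  Let \<open>T = M\<^sup>T (D \<oplus> D) M\<close> and let \<open>q\<close> have both components in the span of eigenvectors of \<open>D\<close>
  for \<open>d\<^sub>1, \<dots>, d\<^sub>j\<close>. The vectors \<open>p = M\<^sup>-\<^sup>1 q\<close> and \<open>p' = M\<^sup>-\<^sup>1 J q\<close> are the real and imaginary parts of
  \<open>M\<^sup>-\<^sup>1 (q + i J q)\<close>. Since \<open>M\<^sup>T q = - J p'\<close>, we get \<open>|q|\<^sup>2 = - \<langle>p, J p'\<rangle> \<le> (|p|\<^sup>2 + |p'|\<^sup>2) / 2\<close>,
  while \<open>\<langle>T p, p\<rangle> + \<langle>T p', p'\<rangle> = 2 \<langle>(D \<oplus> D) q, q\<rangle>\<close>. There are \<open>2 j\<close> real parameters in \<open>q\<close>, so some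
  \<open>q \<noteq> 0\<close> makes both \<open>p\<close> and \<open>p'\<close> orthogonal to the at most \<open>j - 1\<close> eigenvectors of \<open>T\<close> beyond \<open>\<lambda>\<^sub>j\<close>,
  as in the min-max principle, and comparing Rayleigh quotients bounds \<open>\<lambda>\<^sub>j\<close> from above by \<open>d\<^sub>j\<close> on the left of
  \<open>\<alpha>\<close>. On the right one argues in the same way with the quotient of \<open>|T p|\<^sup>2\<close> by \<open>\<langle>T p, p\<rangle>\<close>, applying the
  same estimate to \<open>(D \<oplus> D) q\<close>.
\<close>

section \<open>Symmetric operators on Hilbert spaces\<close>

lemma quadratic_nonneg_imp_discriminant:
  fixes a b c :: real
  assumes nonneg: "\<And>t. a + 2 * t * b + t\<^sup>2 * c \<ge> 0"
  shows "b\<^sup>2 \<le> a * c"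
proof (cases "c = 0")
  case True
  have "b = 0"
  proof (rule ccontr)
    assume "b \<noteq> 0"
    with nonneg[of "- (a + 1) / (2 * b)"] True show False
      by (simp add: field_simps)
  qed
  with True show ?thesis by simp
next
  case False
  have "c > 0"
  proof (rule ccontr)
    assume "\<not> c > 0"
    with False have c: "c < 0" by simp
    \<comment> \<open>Adding the values at t and -t cancels the linear term. This t is at least 1
      and makes \<open>t * c\<close> less than \<open>- \<bar>a\<bar>\<close>, so
      \<open>a + t * (t * c)\<close> is negative.\<close>
    define t where "t = (\<bar>b\<bar> + \<bar>a\<bar> + 1) / (- c) + 1"
    have t1: "t \<ge> 1" and tc: "t * c = - (\<bar>b\<bar> + \<bar>a\<bar> + 1) + c"
      using c by (auto simp: t_def field_simps)
    have "a + 2 * t * b + t\<^sup>2 * c + (a + 2 * (-t) * b + (-t)\<^sup>2 * c) \<ge> 0"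
      using nonneg[of t] nonneg[of "-t"] by linarith
    hence "a + t * (t * c) \<ge> 0" by (simp add: power2_eq_square algebra_simps)
    moreover have "t * (t * c) \<le> 1 * (t * c)"
      using t1 tc c by (intro mult_right_mono_neg) auto
    ultimately show False using tc c by linarith
  qed
  with nonneg[of "- b / c"] show ?thesis
    by (simp add: field_simps power2_eq_square)
qed

lemma psd_Cauchy_Schwarz:
  fixes A :: "'a::real_inner \<Rightarrow> 'a"
  assumes "linear A" and sym: "\<And>x y. A x \<bullet> y = x \<bullet> A y" and "subspace N"
    and psd: "\<And>x. x \<in> N \<Longrightarrow> A x \<bullet> x \<ge> 0" and xy: "x \<in> N" "y \<in> N"
  shows "(A x \<bullet> y)\<^sup>2 \<le> (A x \<bullet> x) * (A y \<bullet> y)"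
proof (rule quadratic_nonneg_imp_discriminant)
  fix t :: real
  interpret linear A by fact
  have "x + t *\<^sub>R y \<in> N"
    using \<open>subspace N\<close> xy by (simp add: subspace_add subspace_scale)
  from psd[OF this] have "A (x + t *\<^sub>R y) \<bullet> (x + t *\<^sub>R y) \<ge> 0" .
  moreover have "A y \<bullet> x = A x \<bullet> y" using sym[of x y] by (simp add: inner_commute)
  ultimately show "A x \<bullet> x + 2 * t * (A x \<bullet> y) + t\<^sup>2 * (A y \<bullet> y) \<ge> 0"
    by (simp add: add scale inner_add_left inner_add_right algebra_simps power2_eq_square)
qed

text \<open>Cauchy-Schwarz for the form of \<open>A\<close>, applied to \<open>x\<close> and
  \<open>A x\<close>, followed by cancelling \<open>A x \<bullet> A x\<close>; invariance of
  \<open>N\<close> is what admits \<open>A x\<close> as the second vector. This turns bounds on the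
  quadratic form into bounds on norms.\<close>

lemma psd_norm_square_le:
  fixes A :: "'a::real_inner \<Rightarrow> 'a"
  assumes "linear A" and sym: "\<And>x y. A x \<bullet> y = x \<bullet> A y" and "subspace N"
    and psd: "\<And>x. x \<in> N \<Longrightarrow> A x \<bullet> x \<ge> 0"
    and inv: "\<And>x. x \<in> N \<Longrightarrow> A x \<in> N"
    and bd: "\<And>x. x \<in> N \<Longrightarrow> A x \<bullet> x \<le> K * (x \<bullet> x)"
    and x: "x \<in> N"
  shows "A x \<bullet> A x \<le> K * (A x \<bullet> x)"
proof (cases "A x = 0")
  case False
  have "(A x \<bullet> A x)\<^sup>2 \<le> (A x \<bullet> x) * (A (A x) \<bullet> A x)"
    using psd_Cauchy_Schwarz[OF assms(1) sym \<open>subspace N\<close> psd x inv[OF x]] by simp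
  also have "\<dots> \<le> (A x \<bullet> x) * (K * (A x \<bullet> A x))"
    by (intro mult_left_mono bd psd inv x)
  finally have "(A x \<bullet> A x) * (A x \<bullet> A x) \<le> (K * (A x \<bullet> x)) * (A x \<bullet> A x)"
    by (simp add: power2_eq_square algebra_simps)
  with False show ?thesis by (simp add: mult_le_cancel_right)
qed simp

section \<open>Riesz representation and existence of adjoints\<close>

lemma Riesz_representation:
  fixes f :: "'a::{real_inner, complete_space} \<Rightarrow> real"
  assumes "bounded_linear f"
  shows "\<exists>x. \<forall>y. f y = x \<bullet> y"
proof -
  interpret bounded_linear f by fact
  \<comment> \<open>The representing vector is the minimiser of this functional, since its gradient
    at \<open>x\<close> is twice the difference between \<open>x\<close> and the sought vector.
    Completing the square bounds it below by \<open>- K\<^sup>2\<close>.\<close>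
  define \<phi> where "\<phi> x = x \<bullet> x - 2 * f x" for x
  obtain K where K: "\<And>x. \<bar>f x\<bar> \<le> norm x * K"
    using nonneg_bounded by auto
  have "- K\<^sup>2 \<le> \<phi> x" for x
  proof -
    have "0 \<le> (norm x - K)\<^sup>2" by simp
    also have "\<dots> = x \<bullet> x - 2 * (norm x * K) + K\<^sup>2"
      by (simp add: power2_diff power2_norm_eq_inner)
    finally show ?thesis using K[of x] by (simp add: \<phi>_def)
  qed
  hence bdd: "bdd_below (range \<phi>)" by (intro bdd_belowI) auto
  define m where "m = Inf (range \<phi>)"
  have m_le: "m \<le> \<phi> x" for x unfolding m_def by (intro cINF_lower bdd) auto
  have "\<exists>x. \<phi> x < m + 1 / real (Suc n)" for n
    using cInf_lessD[of "range \<phi>" "m + 1 / real (Suc n)"] by (auto simp: m_def)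
  then obtain X where X: "\<And>n. \<phi> (X n) < m + 1 / real (Suc n)" by metis
  \<comment> \<open>Parallelogram law: the terms in \<open>f\<close> cancel. As the midpoint has
    value at least \<open>m\<close>, almost minimal points are close to each other.\<close>
  have par: "(dist x y)\<^sup>2 = 2 * \<phi> x + 2 * \<phi> y - 4 * \<phi> ((1/2) *\<^sub>R (x + y))" for x y
    unfolding \<phi>_def scale add dist_norm power2_norm_eq_inner
    by (simp add: inner_add_left inner_add_right inner_diff_left inner_diff_right algebra_simps inner_commute)
  have dist_X: "(dist (X i) (X j))\<^sup>2 \<le> 2 / real (Suc i) + 2 / real (Suc j)" for i j
    using par[of "X i" "X j"] X[of i] X[of j] m_le[of "(1/2) *\<^sub>R (X i + X j)"] by simp
  have "Cauchy X"
  proof (rule metric_CauchyI)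
    fix e :: real assume e: "e > 0"
    obtain n where n: "4 / e\<^sup>2 < real n" using reals_Archimedean2 by blast
    have "dist (X i) (X j) < e" if "i \<ge> n" "j \<ge> n" for i j
    proof -
      have "n > 0" using n e by (cases n) (auto simp: field_simps)
      have "2 / real (Suc i) \<le> 2 / real n" "2 / real (Suc j) \<le> 2 / real n"
        using that \<open>n > 0\<close> by (auto intro!: divide_left_mono)
      hence "(dist (X i) (X j))\<^sup>2 \<le> 4 / real n" using dist_X[of i j] by simp
      also have "\<dots> < e\<^sup>2" using n e \<open>n > 0\<close> by (simp add: field_simps)
      finally show ?thesis using e by (simp add: power_less_imp_less_base)
    qed
    thus "\<exists>M. \<forall>i\<ge>M. \<forall>j\<ge>M. dist (X i) (X j) < e" by blast
  qed
  then obtain x where lim: "X \<longlonglongrightarrow> x" using Cauchy_convergent convergent_def by blast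
  have "(\<lambda>n. \<phi> (X n)) \<longlonglongrightarrow> \<phi> x"
    unfolding \<phi>_def by (intro tendsto_intros lim tendsto)
  moreover have "(\<lambda>n. m + 1 / real (Suc n)) \<longlonglongrightarrow> m + 0"
    by (intro tendsto_intros LIMSEQ_Suc lim_1_over_n)
  ultimately have "\<phi> x \<le> m" 
    using X by (intro LIMSEQ_le[of "\<lambda>n. \<phi> (X n)" "\<phi> x" _ m]) (auto intro: less_imp_le)
  have "f y = x \<bullet> y" for y
  proof -
    \<comment> \<open>The first variation at the minimum: with constant term 0, the discriminant
      bound forces the linear coefficient to vanish.\<close>
    have "0 + 2 * t * (x \<bullet> y - f y) + t\<^sup>2 * (y \<bullet> y) \<ge> 0" for t
    proof -
      have "\<phi> x \<le> \<phi> (x + t *\<^sub>R y)" using \<open>\<phi> x \<le> m\<close> m_le order_trans by blast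
      thus ?thesis
        by (simp add: \<phi>_def add scale inner_add_left inner_add_right inner_commute
            algebra_simps power2_eq_square)
    qed
    from quadratic_nonneg_imp_discriminant[OF this] show ?thesis by simp
  qed
  thus ?thesis by blast
qed

lemma adjoint_works_Hilbert:
  fixes f :: "'a::{real_inner, complete_space} \<Rightarrow> 'b::real_inner"
  assumes "bounded_linear f"
  shows "f x \<bullet> y = x \<bullet> adjoint f y"
proof -
  have "\<exists>z. \<forall>x. f x \<bullet> y = z \<bullet> x" for y
    by (intro Riesz_representation bounded_linear_compose[OF bounded_linear_inner_left assms])
  then obtain g where "\<And>x y. f x \<bullet> y = g y \<bullet> x" by metis
  hence "\<forall>x y. f x \<bullet> y = x \<bullet> g y" by (simp add: inner_commute)
  moreover from adjoint_unique[OF this] have "adjoint f = g" .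
  ultimately show ?thesis by simp
qed

lemma positive_operator_symmetric:
  fixes A :: "'a::{real_inner, complete_space} \<Rightarrow> 'a"
  assumes "positive_operator A"
  shows "A x \<bullet> y = x \<bullet> A y"
  using assms adjoint_works_Hilbert[of A x y] by (simp add: positive_operator_def)

text \<open>The supremum \<open>m\<close> of the Rayleigh quotient on \<open>N\<close> is attained,
  and a maximiser is an eigenvector for \<open>m\<close>. Compactness of \<open>A - \<alpha>\<close>
  suffices because \<open>m\<close> lies strictly above \<open>\<alpha>\<close>.\<close>

lemma max_Rayleigh_quotient_eigenvector:
  fixes A :: "'a::real_inner \<Rightarrow> 'a"
  assumes bl: "bounded_linear A" and sym: "\<And>x y. A x \<bullet> y = x \<bullet> A y"
    and cpt: "compact_operator (\<lambda>x. A x - \<alpha> *\<^sub>R x)"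
    and N: "subspace N" "closed N" "\<And>x. x \<in> N \<Longrightarrow> A x \<in> N"
    and x0: "x0 \<in> N" "A x0 \<bullet> x0 > \<mu> * (x0 \<bullet> x0)" and "\<mu> \<ge> \<alpha>"
  shows "\<exists>x\<in>N. x \<noteq> 0 \<and> (\<exists>\<nu>>\<mu>. A x = \<nu> *\<^sub>R x)"
proof -
  interpret bounded_linear A by fact
  obtain K where K: "K \<ge> 0" "\<And>x. norm (A x) \<le> norm x * K" using nonneg_bounded by blast
  define R where "R = (\<lambda>x. A x \<bullet> x) ` {x\<in>N. norm x = 1}"
  have form_le: "\<bar>A x \<bullet> x\<bar> \<le> K * (x \<bullet> x)" for x
  proof -
    have "\<bar>A x \<bullet> x\<bar> \<le> norm (A x) * norm x" by (rule Cauchy_Schwarz_ineq2)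
    also have "\<dots> \<le> norm x * K * norm x" by (intro mult_right_mono K) auto
    finally show ?thesis by (simp add: dot_square_norm power2_eq_square algebra_simps)
  qed
  have bdd: "bdd_above R"
  proof (rule bdd_aboveI)
    fix r assume "r \<in> R"
    then obtain x where "r = A x \<bullet> x" "norm x = 1" by (auto simp: R_def)
    with form_le[of x] show "r \<le> K" by (simp add: norm_eq_1)
  qed
  define m where "m = Sup R"
  have scaled: "A x \<bullet> x = (A (x /\<^sub>R norm x) \<bullet> (x /\<^sub>R norm x)) * (x \<bullet> x)" if "x \<noteq> 0" for x
    using that by (simp add: scale dot_square_norm power2_eq_square field_simps)
  have in_R: "A (x /\<^sub>R norm x) \<bullet> (x /\<^sub>R norm x) \<in> R" if "x \<in> N" "x \<noteq> 0" for x
    unfolding R_def using that N(1) by (intro imageI) (simp add: subspace_scale)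
  have le_m: "A x \<bullet> x \<le> m * (x \<bullet> x)" if "x \<in> N" for x
  proof (cases "x = 0")
    case False
    with cSup_upper[OF in_R[OF that] bdd] show ?thesis
      by (subst scaled) (auto intro: mult_right_mono simp: m_def)
  qed simp
  have "x0 \<noteq> 0" using x0 by (auto simp: zero)
  have "\<mu> < m"
  proof -
    have "\<mu> * (x0 \<bullet> x0) < m * (x0 \<bullet> x0)" using x0 le_m[of x0] by simp
    thus ?thesis by (simp add: mult_less_cancel_right \<open>x0 \<noteq> 0\<close>)
  qed
  have "\<exists>x\<in>N. norm x = 1 \<and> m - 1 / real (Suc n) < A x \<bullet> x" for n
  proof -
    have "R \<noteq> {}" using in_R[OF x0(1) \<open>x0 \<noteq> 0\<close>] by auto
    from less_cSupD[OF this, of "m - 1 / real (Suc n)"] show ?thesis by (auto simp: m_def R_def)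
  qed
  then obtain X where X: "\<And>n. X n \<in> N" "\<And>n. norm (X n) = 1"
    "\<And>n. m - 1 / real (Suc n) < A (X n) \<bullet> X n" by metis
  \<comment> \<open>\<open>B\<close> is positive semidefinite on \<open>N\<close> and its form tends
    to 0 along the maximising sequence \<open>X\<close>, so \<open>psd_norm_square_le\<close> gives
    convergence of \<open>B (X n)\<close> to 0 in norm.\<close>
  define B where "B x = m *\<^sub>R x - A x" for x
  have blB: "bounded_linear B"
    unfolding B_def by (intro bounded_linear_sub bounded_linear_scaleR_right bl)
  have B_sq: "B x \<bullet> B x \<le> (\<bar>m\<bar> + K) * (B x \<bullet> x)" if "x \<in> N" for x
  proof (rule psd_norm_square_le[of B N])
    show "linear B" using blB by (simp add: bounded_linear.linear)
    show "B x \<bullet> y = x \<bullet> B y" for x y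
      by (simp add: B_def inner_diff_left inner_diff_right sym)
    show "B x \<bullet> x \<ge> 0" if "x \<in> N" for x
      using le_m[OF that] by (simp add: B_def inner_diff_left)
    show "B x \<in> N" if "x \<in> N" for x
      using that N by (simp add: B_def subspace_diff subspace_scale)
    show "B x \<bullet> x \<le> (\<bar>m\<bar> + K) * (x \<bullet> x)" for x
    proof -
      have "m * (x \<bullet> x) \<le> \<bar>m\<bar> * (x \<bullet> x)" by (intro mult_right_mono) auto
      thus ?thesis using form_le[of x] by (simp add: B_def inner_diff_left algebra_simps)
    qed
  qed (use N that in auto)
  have "(\<lambda>n. norm (B (X n)) ^ 2) \<longlonglongrightarrow> 0"
  proof (rule tendsto_sandwich[of "\<lambda>_. 0" _ _ "\<lambda>n. (\<bar>m\<bar> + K) * (1 / real (Suc n))"])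
    show "(\<lambda>n. (\<bar>m\<bar> + K) * (1 / real (Suc n))) \<longlonglongrightarrow> 0"
      by (intro tendsto_mult_right_zero LIMSEQ_Suc lim_1_over_n)
    have "norm (B (X n)) ^ 2 \<le> (\<bar>m\<bar> + K) * (1 / real (Suc n))" for n
    proof -
      have "X n \<bullet> X n = 1" using X(2) by (simp add: norm_eq_1)
      hence "B (X n) \<bullet> X n \<le> 1 / real (Suc n)"
        using X(3)[of n] by (simp add: B_def inner_diff_left)
      hence "(\<bar>m\<bar> + K) * (B (X n) \<bullet> X n) \<le> (\<bar>m\<bar> + K) * (1 / real (Suc n))"
        by (intro mult_left_mono) (use K in auto)
      thus ?thesis using B_sq[OF X(1)[of n]] by (simp add: power2_norm_eq_inner)
    qed
    thus "\<forall>\<^sub>F n in sequentially. norm (B (X n)) ^ 2 \<le> (\<bar>m\<bar> + K) * (1 / real (Suc n))" by simp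
  qed auto
  hence "(\<lambda>n. norm (B (X n))) \<longlonglongrightarrow> 0"
    by (rule iffD1[OF power_tendsto_0_iff, rotated]) simp
  hence BX: "(\<lambda>n. B (X n)) \<longlonglongrightarrow> 0" by (rule tendsto_norm_zero_cancel)
  have "bounded (range X)" using X(2) by (auto simp: bounded_iff)
  hence "compact (closure ((\<lambda>x. A x - \<alpha> *\<^sub>R x) ` range X))"
    using cpt by (simp add: compact_operator_def)
  hence "seq_compact (closure ((\<lambda>x. A x - \<alpha> *\<^sub>R x) ` range X))"
    by (simp add: compact_imp_seq_compact)
  moreover have "\<forall>n. A (X n) - \<alpha> *\<^sub>R X n \<in> closure ((\<lambda>x. A x - \<alpha> *\<^sub>R x) ` range X)"
    by (intro allI subsetD[OF closure_subset]) blast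
  ultimately obtain y r where r: "strict_mono r"
    and "((\<lambda>n. A (X n) - \<alpha> *\<^sub>R X n) \<circ> r) \<longlonglongrightarrow> y"
    by (rule seq_compactE[where f = "\<lambda>n. A (X n) - \<alpha> *\<^sub>R X n"]) (rule that)
  moreover have "((\<lambda>n. B (X n)) \<circ> r) \<longlonglongrightarrow> 0" using BX r by (rule LIMSEQ_subseq_LIMSEQ)
  \<comment> \<open>Along the subsequence both \<open>B X\<close> and
    \<open>A X - \<alpha> X\<close> converge, and their sum is \<open>(m - \<alpha>) X\<close>;
    dividing by the positive number \<open>m - \<alpha>\<close> makes \<open>X\<close> itself
    converge.\<close>
  ultimately have "(\<lambda>n. (1 / (m - \<alpha>)) *\<^sub>R (((\<lambda>n. B (X n)) \<circ> r) n +
      ((\<lambda>n. A (X n) - \<alpha> *\<^sub>R X n) \<circ> r) n)) \<longlonglongrightarrow> (1 / (m - \<alpha>)) *\<^sub>R (0 + y)"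
    by (intro tendsto_intros)
  moreover have "(1 / (m - \<alpha>)) *\<^sub>R (((\<lambda>n. B (X n)) \<circ> r) n +
      ((\<lambda>n. A (X n) - \<alpha> *\<^sub>R X n) \<circ> r) n) = X (r n)" for n
  proof -
    have "((\<lambda>n. B (X n)) \<circ> r) n + ((\<lambda>n. A (X n) - \<alpha> *\<^sub>R X n) \<circ> r) n = (m - \<alpha>) *\<^sub>R X (r n)"
      by (simp add: B_def algebra_simps)
    thus ?thesis using \<open>\<mu> < m\<close> \<open>\<mu> \<ge> \<alpha>\<close> by simp
  qed
  ultimately obtain x where x: "(\<lambda>n. X (r n)) \<longlonglongrightarrow> x" by auto
  have "x \<in> N" using N(2) X(1) x by (metis closed_sequentially)
  moreover have "norm x = 1"
    using tendsto_norm[OF x] X(2) by (simp add: LIMSEQ_const_iff)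
  hence "x \<noteq> 0" by auto
  moreover have "B x = 0"
    using bounded_linear.tendsto[OF blB x] LIMSEQ_subseq_LIMSEQ[OF BX r]
    unfolding o_def by (rule LIMSEQ_unique)
  hence "A x = m *\<^sub>R x" by (simp add: B_def)
  ultimately show ?thesis using \<open>\<mu> < m\<close> by blast
qed

section \<open>Eigenvectors and multiplicities\<close>

lemma cscale_Pair: "cscale z (x, y) = (Re z *\<^sub>R x - Im z *\<^sub>R y, Im z *\<^sub>R x + Re z *\<^sub>R y)"
  by (simp add: cscale_def)

text \<open>For real \<open>\<mu>\<close> the complex eigenspace is \<open>E \<times> E\<close> with
  \<open>E\<close> the real eigenspace, so its complex dimension is the real dimension of
  \<open>E\<close>. All later counting can then be done with real vectors.\<close>

lemma real_basis_of_eigenspace: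
  fixes A :: "'a::real_inner \<Rightarrow> 'a"
  assumes "linear A" and mult: "eigen_multiplicity A (complex_of_real \<mu>) = enat k"
  shows "\<exists>B. finite B \<and> card B = k \<and> 0 \<notin> B \<and> pairwise orthogonal B \<and> span B = {x. A x = \<mu> *\<^sub>R x}"
proof -
  interpret linear A by fact
  define E where "E = {x. A x = \<mu> *\<^sub>R x}"
  have sub_E: "subspace E"
    by (auto simp: subspace_def E_def add scale algebra_simps)
  have eig: "eigenspace A (complex_of_real \<mu>) = E \<times> E"
    by (auto simp: eigenspace_def E_def complexify_def cscale_Pair)
  from mult obtain C where "finite C" and C: "E \<times> E \<subseteq> complexification.span C"
    by (auto simp: eigen_multiplicity_def eig split: if_splits)
  \<comment> \<open>The real span of all components of the complex generators:
    \<open>W \<times> W\<close> is a complex subspace containing them, hence contains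
    \<open>E \<times> E\<close>, which shows that \<open>E\<close> is finite-dimensional.\<close>
  define W where "W = span (fst ` C \<union> snd ` C)"
  have "complexification.span C \<subseteq> W \<times> W"
  proof (rule complexification.span_minimal)
    show "C \<subseteq> W \<times> W" unfolding W_def
    proof
      fix c assume "c \<in> C"
      hence "fst c \<in> fst ` C \<union> snd ` C" "snd c \<in> fst ` C \<union> snd ` C" by auto
      thus "c \<in> span (fst ` C \<union> snd ` C) \<times> span (fst ` C \<union> snd ` C)"
        by (simp add: mem_Times_iff span_base)
    qed
    show "complexification.subspace (W \<times> W)"
      unfolding complexification.subspace_def W_def
      by (auto simp: cscale_Pair zero_prod_def intro!: span_add span_diff span_scale span_zero)
  qed
  with C sub_E have "E \<subseteq> W" using subspace_0 by blast
  obtain B0 where B0: "B0 \<subseteq> E" "independent B0" "E \<subseteq> span B0" by (rule basis_exists[of E])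
  have "finite B0"
    by (rule conjunct1, rule independent_span_bound[of "fst ` C \<union> snd ` C"])
      (use B0 \<open>E \<subseteq> W\<close> \<open>finite C\<close> in \<open>auto simp: W_def\<close>)
  from basis_orthogonal[OF this] obtain B1
    where B1: "finite B1" "span B1 = span B0" "pairwise orthogonal B1" by blast
  define B where "B = B1 - {0}"
  have B: "finite B" "0 \<notin> B" "pairwise orthogonal B"
    using B1 by (auto simp: B_def intro: pairwise_subset)
  have "span B0 = E" using B0 sub_E by (simp add: span_minimal subset_antisym)
  with B1 have span_B: "span B = E" by (simp add: B_def span_delete_0)
  have indep_B: "independent B" by (intro pairwise_orthogonal_independent B)
  \<comment> \<open>A real basis, placed in the real part, is a complex basis: multiplication by
    \<open>\<i>\<close> supplies the imaginary parts, and a complex relation splits into two real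
    ones.\<close>
  define B' where "B' = (\<lambda>x. (x, 0::'a)) ` B"
  have "complexification.dim (E \<times> E) = card B"
  proof (rule complexification.dim_unique)
    show "B' \<subseteq> E \<times> E"
      using span_B span_superset[of B] subspace_0[OF sub_E] by (auto simp: B'_def)
    have E_B': "(x, 0) \<in> complexification.span B'" if "x \<in> E" for x
    proof -
      have "x \<in> span B" using that span_B by simp
      thus ?thesis
      proof (induction rule: span_induct_alt)
        case base
        show ?case using complexification.span_zero by (simp add: zero_prod_def)
      next
        case (step c x y)
        have "(x, 0) \<in> complexification.span B'"
          using step by (auto simp: B'_def intro: complexification.span_base)
        from complexification.span_add[OF complexification.span_scale[OF this, of "complex_of_real c"] step(2)]
        show ?case by (simp add: cscale_Pair)
      qed
    qed
    show "E \<times> E \<subseteq> complexification.span B'"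
    proof
      fix z assume "z \<in> E \<times> E"
      then obtain x y where z: "z = (x, y)" "x \<in> E" "y \<in> E" by auto
      from complexification.span_add[OF E_B'[OF z(2)]
          complexification.span_scale[OF E_B'[OF z(3)], of \<i>]]
      show "z \<in> complexification.span B'" by (simp add: cscale_Pair z)
    qed
    have inj: "inj_on (\<lambda>x. (x, 0::'a)) B" by (auto simp: inj_on_def)
    show "card B' = card B" unfolding B'_def by (rule card_image[OF inj])
    have "u v = 0" if sum0: "(\<Sum>v\<in>B'. cscale (u v) v) = 0" and v: "v \<in> B'" for u v
    proof -
      obtain b where b: "b \<in> B" "v = (b, 0)" using v by (auto simp: B'_def)
      have "(\<Sum>v\<in>B'. cscale (u v) v) = (\<Sum>x\<in>B. (Re (u (x, 0)) *\<^sub>R x, Im (u (x, 0)) *\<^sub>R x))"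
        unfolding B'_def by (simp add: sum.reindex[OF inj] cscale_Pair)
      with sum0 have "(\<Sum>x\<in>B. Re (u (x, 0)) *\<^sub>R x) = 0" "(\<Sum>x\<in>B. Im (u (x, 0)) *\<^sub>R x) = 0"
        by (simp_all add: sum_prod prod_eq_iff)
      from independentD[OF indep_B B(1) order_refl this(1) b(1)]
        independentD[OF indep_B B(1) order_refl this(2) b(1)]
      have "Re (u v) = 0" "Im (u v) = 0" by (simp_all add: b)
      thus ?thesis by (simp add: complex_eq_iff)
    qed
    moreover have "finite B'" using B by (simp add: B'_def)
    ultimately show "complexification.independent B'"
      by (auto simp: complexification.dependent_finite)
  qed
  moreover have "k = complexification.dim (E \<times> E)"
    using mult by (auto simp: eigen_multiplicity_def eig split: if_splits)
  ultimately show ?thesis using B span_B unfolding E_def by auto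
qed

text \<open>By symmetry, eigenvectors for distinct eigenvalues are orthogonal, so orthogonal bases
  of the eigenspaces are disjoint and their union is again orthogonal.\<close>

lemma orthogonal_eigenvectors:
  fixes A :: "'a::real_inner \<Rightarrow> 'a"
  assumes "linear A" and sym: "\<And>x y. A x \<bullet> y = x \<bullet> A y" and "finite \<Lambda>"
    and mult: "\<And>\<nu>. \<nu> \<in> \<Lambda> \<Longrightarrow> eigen_multiplicity A (complex_of_real \<nu>) = enat (k \<nu>)"
  shows "\<exists>G. finite G \<and> card G = sum k \<Lambda> \<and> 0 \<notin> G \<and> pairwise orthogonal G \<and>
    (\<forall>e\<in>G. \<exists>\<nu>\<in>\<Lambda>. A e = \<nu> *\<^sub>R e) \<and> (\<forall>\<nu>\<in>\<Lambda>. {x. A x = \<nu> *\<^sub>R x} \<subseteq> span G)"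
proof -
  have "\<forall>\<nu>\<in>\<Lambda>. \<exists>B. finite B \<and> card B = k \<nu> \<and> 0 \<notin> B \<and> pairwise orthogonal B \<and>
      span B = {x. A x = \<nu> *\<^sub>R x}"
    using real_basis_of_eigenspace[OF \<open>linear A\<close> mult] by blast
  then obtain B where B: "\<And>\<nu>. \<nu> \<in> \<Lambda> \<Longrightarrow> finite (B \<nu>) \<and> card (B \<nu>) = k \<nu> \<and> 0 \<notin> B \<nu> \<and>
      pairwise orthogonal (B \<nu>) \<and> span (B \<nu>) = {x. A x = \<nu> *\<^sub>R x}"
    by metis
  have eig: "A x = \<nu> *\<^sub>R x" if "\<nu> \<in> \<Lambda>" "x \<in> B \<nu>" for \<nu> x
    using B[OF that(1)] span_base[OF that(2)] by blast
  have orth: "x \<bullet> y = 0" if "\<nu> \<in> \<Lambda>" "x \<in> B \<nu>" "\<nu>' \<in> \<Lambda>" "y \<in> B \<nu>'" "\<nu> \<noteq> \<nu>'" for \<nu> \<nu>' x y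
    using sym[of x y] eig[OF that(1,2)] eig[OF that(3,4)] that(5) by simp
  define G where "G = (\<Union>\<nu>\<in>\<Lambda>. B \<nu>)"
  have "B \<nu> \<inter> B \<nu>' = {}" if "\<nu> \<in> \<Lambda>" "\<nu>' \<in> \<Lambda>" "\<nu> \<noteq> \<nu>'" for \<nu> \<nu>'
  proof (rule equals0I)
    fix x assume "x \<in> B \<nu> \<inter> B \<nu>'"
    hence "x \<bullet> x = 0" "x \<in> B \<nu>" using orth that by blast+
    thus False using B[OF that(1)] by auto
  qed
  hence "card G = sum k \<Lambda>"
    unfolding G_def using B \<open>finite \<Lambda>\<close> by (subst card_UN_disjoint) auto
  moreover have "pairwise orthogonal G"
  proof (rule pairwiseI)
    fix x y assume "x \<in> G" "y \<in> G" "x \<noteq> y"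
    then obtain \<nu> \<nu>' where \<nu>: "\<nu> \<in> \<Lambda>" "\<nu>' \<in> \<Lambda>" "x \<in> B \<nu>" "y \<in> B \<nu>'" by (auto simp: G_def)
    show "orthogonal x y"
    proof (cases "\<nu> = \<nu>'")
      case True
      with \<nu> B[OF \<nu>(1)] \<open>x \<noteq> y\<close> show ?thesis by (auto simp: pairwise_def)
    next
      case False
      with \<nu> orth show ?thesis by (auto simp: orthogonal_def)
    qed
  qed
  moreover have "{x. A x = \<nu> *\<^sub>R x} \<subseteq> span G" if "\<nu> \<in> \<Lambda>" for \<nu>
    using B[OF that] span_mono[of "B \<nu>" G] that by (auto simp: G_def)
  moreover have "finite G" "0 \<notin> G" using B \<open>finite \<Lambda>\<close> by (auto simp: G_def)
  moreover have "\<forall>e\<in>G. \<exists>\<nu>\<in>\<Lambda>. A e = \<nu> *\<^sub>R e" using eig by (auto simp: G_def)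
  ultimately show ?thesis by blast
qed

section \<open>The two halves of the min-max principle\<close>

lemma eigenvalues_right_multiplicity:
  assumes "eigenvalues_right A \<alpha> n f" "\<mu> > \<alpha>"
  shows "eigen_multiplicity A (complex_of_real \<mu>) = enat (card {j \<in> index_set n. f j = \<mu>})"
    and "finite {j \<in> index_set n. f j = \<mu>}"
  using assms by (auto simp: eigenvalues_right_def)

lemma index_set_downward: "i \<in> index_set n" if "j \<in> index_set n" "1 \<le> i" "i \<le> j"
  using that by (simp add: index_set_def) (meson enat_ord_simps(1) order_trans)

text \<open>\<open>G\<close> collects full eigenspace bases for the values
  \<open>f 1, ..., f j\<close>. If \<open>f j\<close> is repeated after position \<open>j\<close>,
  this gives more than \<open>j\<close> vectors, hence only the lower bound on
  \<open>card G\<close>.\<close>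

lemma eigenvectors_of_largest_eigenvalues:
  fixes A :: "'a::real_inner \<Rightarrow> 'a"
  assumes "linear A" and sym: "\<And>x y. A x \<bullet> y = x \<bullet> A y"
    and ev: "eigenvalues_right A \<alpha> n f" and j: "j \<in> index_set n"
  shows "\<exists>G. finite G \<and> j \<le> card G \<and> 0 \<notin> G \<and> pairwise orthogonal G \<and>
    (\<forall>e\<in>G. \<exists>\<nu>\<ge>f j. A e = \<nu> *\<^sub>R e)"
proof -
  define k where "k \<nu> = card {i \<in> index_set n. f i = \<nu>}" for \<nu>
  define \<Lambda> where "\<Lambda> = f ` {1..j}"
  have idx: "i \<in> index_set n" if "i \<in> {1..j}" for i
    using index_set_downward[OF j] that by simp
  have gt: "\<nu> > \<alpha>" and ge: "\<nu> \<ge> f j" if "\<nu> \<in> \<Lambda>" for \<nu>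
    using that ev idx j by (auto simp: \<Lambda>_def eigenvalues_right_def)
  have "\<exists>G. finite G \<and> card G = sum k \<Lambda> \<and> 0 \<notin> G \<and> pairwise orthogonal G \<and>
      (\<forall>e\<in>G. \<exists>\<nu>\<in>\<Lambda>. A e = \<nu> *\<^sub>R e) \<and> (\<forall>\<nu>\<in>\<Lambda>. {x. A x = \<nu> *\<^sub>R x} \<subseteq> span G)"
    by (rule orthogonal_eigenvectors[OF assms(1) sym])
      (use eigenvalues_right_multiplicity[OF ev gt] in \<open>auto simp: \<Lambda>_def k_def\<close>)
  moreover have "j \<le> sum k \<Lambda>"
  proof -
    have fin: "finite {i \<in> index_set n. f i = \<nu>}" if "\<nu> \<in> \<Lambda>" for \<nu>
      using eigenvalues_right_multiplicity(2)[OF ev gt[OF that]] .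
    have "j = card {1..j}" by simp
    also have "\<dots> \<le> card (\<Union>\<nu>\<in>\<Lambda>. {i \<in> index_set n. f i = \<nu>})"
      by (intro card_mono finite_UN_I fin) (use idx in \<open>auto simp: \<Lambda>_def\<close>)
    also have "\<dots> \<le> sum k \<Lambda>"
      unfolding k_def by (rule card_UN_le) (simp add: \<Lambda>_def)
    finally show ?thesis .
  qed
  ultimately show ?thesis using ge by (metis (no_types, lifting))
qed

text \<open>\<open>F\<close> spans the eigenspaces for all eigenvalues above \<open>\<mu>\<close>. A
  Rayleigh quotient above \<open>\<mu>\<close> on its orthogonal complement would yield another such
  eigenvector there, which would be orthogonal to itself. The threshold is a free parameter so that
  it can be \<open>\<alpha>\<close> when the arrangement has fewer than \<open>j\<close>
  terms.\<close>

lemma eigenvectors_above: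
  fixes A :: "'a::real_inner \<Rightarrow> 'a"
  assumes bl: "bounded_linear A" and sym: "\<And>x y. A x \<bullet> y = x \<bullet> A y"
    and cpt: "compact_operator (\<lambda>x. A x - \<alpha> *\<^sub>R x)"
    and ev: "eigenvalues_right A \<alpha> n f" and \<mu>: "\<mu> \<ge> \<alpha>"
    and few: "{i \<in> index_set n. f i > \<mu>} \<subseteq> {1..<j}" and "j \<ge> 1"
  shows "\<exists>F. finite F \<and> card F < j \<and> (\<forall>e\<in>F. \<exists>\<nu>. A e = \<nu> *\<^sub>R e) \<and>
    (\<forall>x. (\<forall>e\<in>F. x \<bullet> e = 0) \<longrightarrow> A x \<bullet> x \<le> \<mu> * (x \<bullet> x))"
proof -
  have lin: "linear A" using bl by (rule bounded_linear.linear)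
  define I where "I = {i \<in> index_set n. f i > \<mu>}"
  define k where "k \<nu> = card {i \<in> index_set n. f i = \<nu>}" for \<nu>
  have "finite I" and "card I < j"
  proof -
    show "finite I" using few finite_subset I_def by blast
    have "card I \<le> card {1..<j}" unfolding I_def by (rule card_mono[OF _ few]) simp
    thus "card I < j" using \<open>j \<ge> 1\<close> by simp
  qed
  have "\<exists>F. finite F \<and> card F = sum k (f ` I) \<and> 0 \<notin> F \<and> pairwise orthogonal F \<and>
      (\<forall>e\<in>F. \<exists>\<nu>\<in>f ` I. A e = \<nu> *\<^sub>R e) \<and> (\<forall>\<nu>\<in>f ` I. {x. A x = \<nu> *\<^sub>R x} \<subseteq> span F)"
    by (rule orthogonal_eigenvectors[OF lin sym])
      (use eigenvalues_right_multiplicity[OF ev] \<mu> \<open>finite I\<close> in \<open>auto simp: k_def I_def\<close>)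
  then obtain F where F: "finite F" "card F = sum k (f ` I)"
    "\<And>e. e \<in> F \<Longrightarrow> \<exists>\<nu>\<in>f ` I. A e = \<nu> *\<^sub>R e"
    and span_F: "\<And>\<nu>. \<nu> \<in> f ` I \<Longrightarrow> {x. A x = \<nu> *\<^sub>R x} \<subseteq> span F" by blast
  \<comment> \<open>Here the count must be exact: the fibres of \<open>f\<close> over values above
    \<open>\<mu>\<close> partition \<open>I\<close>, so \<open>F\<close> has as many vectors as
    \<open>I\<close> has indices.\<close>
  have "sum k (f ` I) = card (\<Union>\<nu>\<in>f ` I. {i \<in> index_set n. f i = \<nu>})"
    unfolding k_def using \<open>finite I\<close> eigenvalues_right_multiplicity(2)[OF ev] \<mu>
    by (intro card_UN_disjoint[symmetric]) (auto simp: I_def)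
  also have "(\<Union>\<nu>\<in>f ` I. {i \<in> index_set n. f i = \<nu>}) = I" by (auto simp: I_def)
  finally have "card F < j" using F(2) \<open>card I < j\<close> by simp
  define N where "N = {x. \<forall>e\<in>F. x \<bullet> e = 0}"
  have "A x \<bullet> x \<le> \<mu> * (x \<bullet> x)" if xN: "x \<in> N" for x
  proof (rule ccontr)
    assume "\<not> ?thesis"
    hence x: "A x \<bullet> x > \<mu> * (x \<bullet> x)" by simp
    have "subspace N" by (auto simp: N_def subspace_def inner_add_left)
    moreover have "closed N"
      unfolding N_def Collect_ball_eq
      by (intro closed_INT ballI closed_Collect_eq continuous_intros)
    moreover have "A y \<in> N" if "y \<in> N" for y
    proof -
      have "A y \<bullet> e = 0" if "e \<in> F" for e
        using F(3)[OF that] \<open>y \<in> N\<close> that by (auto simp: N_def sym)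
      thus ?thesis by (simp add: N_def)
    qed
    ultimately obtain y \<nu> where y: "y \<in> N" "y \<noteq> 0" "\<nu> > \<mu>" "A y = \<nu> *\<^sub>R y"
      using max_Rayleigh_quotient_eigenvector[OF bl sym cpt _ _ _ xN x \<mu>] by blast
    \<comment> \<open>The arrangement exhausts the eigenvalues to the right of
      \<open>\<alpha>\<close>: a value it omits has multiplicity 0 and thus a trivial eigenspace,
      contradicting \<open>y\<close>.\<close>
    have "\<nu> \<in> f ` I"
    proof (rule ccontr)
      assume "\<nu> \<notin> f ` I"
      hence "{i \<in> index_set n. f i = \<nu>} = {}" using y by (auto simp: I_def)
      hence "eigen_multiplicity A (complex_of_real \<nu>) = enat 0"
        using eigenvalues_right_multiplicity(1)[OF ev, of \<nu>] y \<mu> by (metis card.empty order.strict_trans1)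
      from real_basis_of_eigenspace[OF lin this] obtain B
        where "finite B" "card B = 0" "span B = {x. A x = \<nu> *\<^sub>R x}" by blast
      hence "{x. A x = \<nu> *\<^sub>R x} = {0}" by simp
      with y show False by blast
    qed
    hence "y \<in> span F" using span_F y by blast
    hence "orthogonal y y"
      by (rule orthogonal_to_span) (use y in \<open>auto simp: N_def orthogonal_def\<close>)
    thus False using y by (simp add: orthogonal_def)
  qed
  thus ?thesis using F \<open>card F < j\<close> by (intro exI[of _ F]) (auto simp: N_def)
qed

section \<open>Comparison of symplectic and ordinary eigenvalues\<close>

lemma linear_nonzero_kernel_in_span:
  assumes "linear f" "independent S" "finite H" "f ` S \<subseteq> span H" "card H < card S"
  shows "\<exists>z\<in>span S. z \<noteq> 0 \<and> f z = 0"
proof (rule ccontr)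
  assume "\<not> ?thesis"
  hence inj: "inj_on f (span S)"
    using linear_injective_on_subspace_0[OF \<open>linear f\<close> subspace_span] by blast
  hence "independent (f ` S)"
    using linear_independent_injective_image[OF \<open>linear f\<close> \<open>independent S\<close>] by simp
  from independent_span_bound[OF \<open>finite H\<close> this assms(4)]
  have "card (f ` S) \<le> card H" by simp
  moreover have "card (f ` S) = card S"
    using inj span_superset by (intro card_image) (rule inj_on_subset)
  ultimately show False using assms(5) by simp
qed

text \<open>The pair \<open>(a, b)\<close> has \<open>2 * card G\<close> real degrees of freedom,
  while the two images have to satisfy only \<open>2 * card F\<close> linear conditions.\<close>

lemma exists_pair_with_orthogonal_images:
  fixes L L' :: "'a::real_inner \<times> 'a \<Rightarrow> 'b::real_inner"
  assumes "linear L" "linear L'" and G: "finite G" "0 \<notin> G" "pairwise orthogonal G"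
    and F: "finite F" "card F < card G"
  shows "\<exists>a\<in>span G. \<exists>b\<in>span G. (a, b) \<noteq> 0 \<and>
    (\<forall>e\<in>F. L (a, b) \<bullet> e = 0 \<and> L' (a, b) \<bullet> e = 0)"
proof -
  define S where "S = (\<lambda>e. (e, 0)) ` G \<union> (\<lambda>e. (0, e)) ` G"
  define H where "H = (\<lambda>e. (e, 0)) ` F \<union> (\<lambda>e. (0, e)) ` F"
  \<comment> \<open>One linear map records all the conditions; its values lie in the span of the at
    most \<open>2 * card F\<close> vectors of \<open>H\<close>, so it has a nonzero kernel vector in
    the span of \<open>S\<close>.\<close>
  define \<Phi> where "\<Phi> q = (\<Sum>e\<in>F. (L q \<bullet> e) *\<^sub>R (e, 0)) + (\<Sum>e\<in>F. (L' q \<bullet> e) *\<^sub>R (0, e))" for q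
  have "independent S"
  proof (rule pairwise_orthogonal_independent)
    show "pairwise orthogonal S"
      using G(3) by (auto simp: S_def pairwise_def orthogonal_def) blast+
    show "0 \<notin> S" using G(2) by (auto simp: S_def zero_prod_def)
  qed
  have "card S = card G + card G"
  proof -
    have "card S = card ((\<lambda>e. (e, 0::'a)) ` G) + card ((\<lambda>e. (0::'a, e)) ` G)"
      unfolding S_def using G by (intro card_Un_disjoint) auto
    thus ?thesis by (simp add: card_image inj_on_def)
  qed
  moreover have "card H \<le> card F + card F"
    unfolding H_def by (rule card_Un_le[THEN order_trans]) (intro add_mono card_image_le F)
  ultimately have less: "card H < card S" using F(2) by simp
  have "linear \<Phi>"
    unfolding \<Phi>_def
    by (intro linear_compose_add linear_compose_sum ballI linearI)
      (auto simp: linear_add[OF assms(1)] linear_add[OF assms(2)] linear_scale[OF assms(1)]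
        linear_scale[OF assms(2)] inner_add_left algebra_simps)
  moreover have "\<Phi> ` S \<subseteq> span H"
    unfolding \<Phi>_def H_def
    by (intro image_subsetI span_add span_sum span_scale) (auto intro: span_base)
  moreover have "finite H" using F by (simp add: H_def)
  ultimately obtain q where q: "q \<in> span S" "q \<noteq> 0" "\<Phi> q = 0"
    using linear_nonzero_kernel_in_span \<open>independent S\<close> less by metis
  have "span S \<subseteq> span G \<times> span G"
  proof (rule span_minimal)
    show "S \<subseteq> span G \<times> span G" by (auto simp: S_def span_base span_zero)
    show "subspace (span G \<times> span G)"
      by (intro subspace_Times subspace_span)
  qed
  with q obtain a b where ab: "q = (a, b)" "a \<in> span G" "b \<in> span G" by blast
  \<comment> \<open>Pairing the zero vector \<open>\<Phi> q\<close> with \<open>(L q, L' q)\<close> gives a vanishing sum of squares.\<close>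
  have "0 = \<Phi> q \<bullet> (L q, L' q)" using q by simp
  also have "\<dots> = (\<Sum>e\<in>F. (L q \<bullet> e)\<^sup>2 + (L' q \<bullet> e)\<^sup>2)"
    by (simp add: \<Phi>_def inner_add_left inner_sum_left sum.distrib power2_eq_square
        inner_commute[of "L q"] inner_commute[of "L' q"])
  finally have "(L q \<bullet> e)\<^sup>2 + (L' q \<bullet> e)\<^sup>2 = 0" if "e \<in> F" for e
    using that F(1) by (subst (asm) eq_commute, subst (asm) sum_nonneg_eq_0_iff) auto
  hence "L q \<bullet> e = 0 \<and> L' q \<bullet> e = 0" if "e \<in> F" for e
    using that by (metis sum_power2_eq_zero_iff)
  with ab q show ?thesis by blast
qed

text \<open>Both bounds compare coefficients in the expansion of \<open>a\<close> over
  \<open>G\<close>. The second one multiplies \<open>\<delta> \<le> \<nu> e\<close> by a further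
  factor \<open>\<nu> e\<close>, whence the sign condition on \<open>\<delta>\<close>.\<close>

lemma eigenvalue_bounds_on_span:
  fixes A :: "'a::real_inner \<Rightarrow> 'a"
  assumes "linear A" and G: "finite G" "pairwise orthogonal G"
    and eig: "\<And>e. e \<in> G \<Longrightarrow> \<exists>\<nu>\<ge>\<delta>. A e = \<nu> *\<^sub>R e" and a: "a \<in> span G"
  shows "\<delta> * (a \<bullet> a) \<le> A a \<bullet> a"
    and "\<delta> \<ge> 0 \<Longrightarrow> \<delta> * (A a \<bullet> a) \<le> A a \<bullet> A a"
proof -
  obtain \<nu> where \<nu>: "\<And>e. e \<in> G \<Longrightarrow> \<nu> e \<ge> \<delta> \<and> A e = \<nu> e *\<^sub>R e" using eig by metis
  obtain c where c: "a = (\<Sum>e\<in>G. c e *\<^sub>R e)" using a G by (auto simp: span_finite)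
  have Aa: "A a = (\<Sum>e\<in>G. (c e * \<nu> e) *\<^sub>R e)"
    unfolding c linear_sum[OF \<open>linear A\<close>] linear_scale[OF \<open>linear A\<close>]
    by (intro sum.cong refl) (simp add: \<nu>)
  have inner_sums: "(\<Sum>e\<in>G. p e *\<^sub>R e) \<bullet> (\<Sum>e\<in>G. r e *\<^sub>R e) = (\<Sum>e\<in>G. p e * r e * (e \<bullet> e))" for p r
  proof -
    have "(\<Sum>e\<in>G. p e *\<^sub>R e) \<bullet> (\<Sum>e\<in>G. r e *\<^sub>R e) = (\<Sum>e\<in>G. \<Sum>e'\<in>G. p e * r e' * (e \<bullet> e'))"
      unfolding inner_sum_left by (simp add: inner_sum_right sum_distrib_left mult_ac)
    also have "\<dots> = (\<Sum>e\<in>G. \<Sum>e'\<in>G. if e' = e then p e * r e * (e \<bullet> e) else 0)"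
      by (intro sum.cong refl) (use G(2) in \<open>auto simp: pairwise_def orthogonal_def\<close>)
    finally show ?thesis using G(1) by simp
  qed
  have "\<delta> * (a \<bullet> a) = (\<Sum>e\<in>G. \<delta> * ((c e)\<^sup>2 * (e \<bullet> e)))"
    by (subst (1 2) c) (simp add: inner_sums sum_distrib_left power2_eq_square mult_ac)
  also have "\<dots> \<le> (\<Sum>e\<in>G. \<nu> e * ((c e)\<^sup>2 * (e \<bullet> e)))"
    by (intro sum_mono mult_right_mono) (use \<nu> in auto)
  also have "\<dots> = A a \<bullet> a"
    by (subst (2) c) (simp add: Aa inner_sums power2_eq_square mult_ac)
  finally show "\<delta> * (a \<bullet> a) \<le> A a \<bullet> a" .
  assume \<delta>: "\<delta> \<ge> 0"
  have "\<delta> * (A a \<bullet> a) = (\<Sum>e\<in>G. \<delta> * (\<nu> e * ((c e)\<^sup>2 * (e \<bullet> e))))"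
    by (subst (2) c) (simp add: Aa inner_sums sum_distrib_left power2_eq_square mult_ac)
  also have "\<dots> \<le> (\<Sum>e\<in>G. \<nu> e * (\<nu> e * ((c e)\<^sup>2 * (e \<bullet> e))))"
    by (intro sum_mono mult_right_mono mult_nonneg_nonneg) (use \<nu> \<delta> order_trans in auto)
  also have "\<dots> = A a \<bullet> A a"
    by (simp add: Aa inner_sums power2_eq_square mult_ac)
  finally show "\<delta> * (A a \<bullet> a) \<le> A a \<bullet> A a" .
qed

section \<open>Symplectic maps and Williamson's form\<close>

lemma J_op_simps:
  fixes x y :: "'a::real_inner \<times> 'a"
  shows "J_op x \<bullet> J_op y = x \<bullet> y" "J_op (J_op x) = - x" "J_op (- x) = - J_op x"
  by (cases x; cases y; simp add: J_op_def)+

lemma linear_J_op: "linear (J_op :: 'a::real_inner \<times> 'a \<Rightarrow> _)"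
  by (rule linearI) (auto simp: J_op_def)

text \<open>The relation for \<open>adjoint M\<close> is the symplectic identity multiplied by the
  inverse \<open>M'\<close> on the right. For the norm estimate, expand the square of
  \<open>M' x + J_op (M' (J_op x))\<close>: the relation turns its cross term into
  \<open>- 2 * (x \<bullet> x)\<close>.\<close>

lemma symplectic_inverse:
  fixes M :: "'a::{real_inner, complete_space} \<times> 'a \<Rightarrow> 'a \<times> 'a"
  assumes "symplectic M"
  obtains M' where "linear M'" "\<And>x. M (M' x) = x"
    "\<And>x. adjoint M (J_op x) = J_op (M' x)"
    "\<And>x. 2 * (x \<bullet> x) \<le> M' x \<bullet> M' x + M' (J_op x) \<bullet> M' (J_op x)"
proof -
  from assms obtain M' where bl: "bounded_linear M" and M': "bounded_linear M'" "M \<circ> M' = id"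
    by (auto simp: symplectic_def invertible_operator_def)
  have J: "adjoint M (J_op (M x)) = J_op x" for x
    using assms comp_eq_dest_lhs[of "adjoint M \<circ> J_op" M J_op x] by (simp add: symplectic_def)
  have inv: "M (M' x) = x" for x by (rule pointfree_idE[OF M'(2)])
  have adj: "adjoint M (J_op x) = J_op (M' x)" for x using J[of "M' x"] by (simp add: inv)
  have "2 * (x \<bullet> x) \<le> M' x \<bullet> M' x + M' (J_op x) \<bullet> M' (J_op x)" for x
  proof -
    have "adjoint M (J_op (J_op (- x))) = J_op (M' (J_op (- x)))" by (rule adj)
    hence "adjoint M x = - J_op (M' (J_op x))"
      using linear_neg[OF bounded_linear.linear[OF M'(1)]] by (simp add: J_op_simps)
    hence "x \<bullet> x = - (M' x \<bullet> J_op (M' (J_op x)))"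
      using adjoint_works_Hilbert[OF bl, of "M' x" x] by (simp add: inv)
    moreover have "0 \<le> (M' x + J_op (M' (J_op x))) \<bullet> (M' x + J_op (M' (J_op x)))" by simp
    ultimately show ?thesis
      by (simp add: inner_add_left inner_add_right J_op_simps inner_commute)
  qed
  with that M' inv adj show thesis using bounded_linear.linear by blast
qed

text \<open>The maps are the inverse of \<open>M\<close> and that inverse composed with
  \<open>J_op\<close>. Since \<open>J_op\<close> commutes with \<open>map_prod D D\<close>, the form
  of \<open>T\<close> takes the same value on both images of \<open>q\<close>.\<close>

lemma williamson_forms:
  fixes T :: "'a::{real_inner, complete_space} \<times> 'a \<Rightarrow> 'a \<times> 'a"
  assumes "symplectic M" and T: "T = adjoint M \<circ> map_prod D D \<circ> M" and "linear D"
  obtains P P' where "linear P" "linear P'"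
    "\<And>q. T (P q) \<bullet> P q = map_prod D D q \<bullet> q" "\<And>q. T (P' q) \<bullet> P' q = map_prod D D q \<bullet> q"
    "\<And>q. 2 * (q \<bullet> q) \<le> P q \<bullet> P q + P' q \<bullet> P' q"
    "\<And>q. 2 * (map_prod D D q \<bullet> map_prod D D q) \<le> T (P q) \<bullet> T (P q) + T (P' q) \<bullet> T (P' q)"
proof -
  obtain M' where M': "linear M'" "\<And>x. M (M' x) = x"
    "\<And>x. adjoint M (J_op x) = J_op (M' x)"
    "\<And>x. 2 * (x \<bullet> x) \<le> M' x \<bullet> M' x + M' (J_op x) \<bullet> M' (J_op x)"
    by (rule symplectic_inverse[OF assms(1)]) (rule that)
  have bl: "bounded_linear M"
    using assms(1) by (simp add: symplectic_def invertible_operator_def)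
  have DJ: "map_prod D D (J_op q) = J_op (map_prod D D q)" for q
    using linear_neg[OF \<open>linear D\<close>] by (cases q) (simp add: J_op_def)
  have T_form: "T (M' q) \<bullet> M' q = map_prod D D q \<bullet> q" for q
    using adjoint_works_Hilbert[OF bl, of "M' q" "map_prod D D q"]
    by (simp add: T M' inner_commute)
  show thesis
  proof (rule that[of M' "\<lambda>q. M' (J_op q)"])
    show "linear (\<lambda>q. M' (J_op q))"
      using linear_compose[OF linear_J_op M'(1)] by (simp add: o_def)
    show "T (M' (J_op q)) \<bullet> M' (J_op q) = map_prod D D q \<bullet> q" for q
      using T_form[of "J_op q"] by (simp add: DJ J_op_simps)
    show "2 * (map_prod D D q \<bullet> map_prod D D q) \<le>
        T (M' q) \<bullet> T (M' q) + T (M' (J_op q)) \<bullet> T (M' (J_op q))" for q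
    proof -
      \<comment> \<open>\<open>T\<close> sends the two vectors to
        \<open>- J_op (M' (J_op s))\<close> and \<open>J_op (M' s)\<close>. As \<open>J_op\<close>
        preserves norms, the claim is the norm estimate of \<open>symplectic_inverse\<close> at
        \<open>s\<close>.\<close>
      define s where "s = map_prod D D q"
      have "T (M' (J_op q)) = J_op (M' s)" by (simp add: T M' DJ s_def)
      moreover have "T (M' q) = adjoint M (J_op (J_op (- s)))"
        by (simp add: T M' s_def J_op_simps)
      hence "T (M' q) = J_op (M' (J_op (- s)))" by (simp only: M')
      hence "T (M' q) = - J_op (M' (J_op s))"
        using linear_neg[OF M'(1)] by (simp add: J_op_simps)
      ultimately show ?thesis using M'(4)[of s] by (simp add: s_def J_op_simps)
    qed
  qed (fact M' T_form)+
qed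

text \<open>The estimate for \<open>P q \<bullet> P q + P' q \<bullet> P' q\<close> bounds the
  denominator of the usual Rayleigh quotient from below, the wrong direction here. So one compares
  \<open>T x \<bullet> T x\<close> with \<open>T x \<bullet> x\<close>, reaching
  \<open>\<delta> * Q \<le> \<mu> * Q\<close>.\<close>

lemma symplectic_eigenvalue_le:
  fixes T :: "'a::{real_inner, complete_space} \<times> 'a \<Rightarrow> 'a \<times> 'a"
  assumes W: "symplectic M" "T = adjoint M \<circ> map_prod D D \<circ> M" and D: "linear D"
    and T: "linear T" "\<And>x y. T x \<bullet> y = x \<bullet> T y" "\<And>x. T x \<bullet> x \<ge> 0"
    and G: "finite G" "0 \<notin> G" "pairwise orthogonal G" "\<And>e. e \<in> G \<Longrightarrow> \<exists>\<nu>\<ge>\<delta>. D e = \<nu> *\<^sub>R e"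
    and F: "finite F" "card F < card G" "\<And>e. e \<in> F \<Longrightarrow> \<exists>\<nu>. T e = \<nu> *\<^sub>R e"
      "\<And>x. (\<forall>e\<in>F. x \<bullet> e = 0) \<Longrightarrow> T x \<bullet> x \<le> \<mu> * (x \<bullet> x)"
    and "\<delta> > 0"
  shows "\<delta> \<le> \<mu>"
proof -
  obtain P P' where P: "linear P" "linear P'"
    "\<And>q. T (P q) \<bullet> P q = map_prod D D q \<bullet> q" "\<And>q. T (P' q) \<bullet> P' q = map_prod D D q \<bullet> q"
    "\<And>q. 2 * (map_prod D D q \<bullet> map_prod D D q) \<le> T (P q) \<bullet> T (P q) + T (P' q) \<bullet> T (P' q)"
    using williamson_forms[OF W D] by metis
  obtain a b where ab: "a \<in> span G" "b \<in> span G" "(a, b) \<noteq> 0"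
    "\<And>e. e \<in> F \<Longrightarrow> P (a, b) \<bullet> e = 0 \<and> P' (a, b) \<bullet> e = 0"
    using exists_pair_with_orthogonal_images[OF P(1,2) G(1-3) F(1,2)] by blast
  define q where "q = (a, b)"
  define Q where "Q = map_prod D D q \<bullet> q"
  note bounds = eigenvalue_bounds_on_span[OF D G(1,3,4)]
  have "\<delta> * (q \<bullet> q) \<le> Q"
    using bounds(1)[OF _ ab(1)] bounds(1)[OF _ ab(2)] by (simp add: q_def Q_def distrib_left)
  moreover have "q \<bullet> q > 0" using ab(3) unfolding q_def inner_gt_zero_iff .
  ultimately have "Q > 0" using \<open>\<delta> > 0\<close> by (smt (verit) mult_pos_pos)
  define N where "N = {x. \<forall>e\<in>F. x \<bullet> e = 0}"
  \<comment> \<open>Because \<open>F\<close> consists of eigenvectors of the symmetric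
    \<open>T\<close>, its orthogonal complement \<open>N\<close> is invariant, so the form bound on
    \<open>N\<close> upgrades to a norm bound.\<close>
  have T_sq: "T x \<bullet> T x \<le> \<mu> * (T x \<bullet> x)" if "x \<in> N" for x
  proof (rule psd_norm_square_le[OF T(1,2), of N])
    show "subspace N" by (auto simp: N_def subspace_def inner_add_left)
    show "T y \<in> N" if "y \<in> N" for y
    proof -
      have "T y \<bullet> e = 0" if "e \<in> F" for e
        using F(3)[OF that] \<open>y \<in> N\<close> that by (auto simp: N_def T(2))
      thus ?thesis by (simp add: N_def)
    qed
  qed (use T F that in \<open>auto simp: N_def\<close>)
  have "P q \<in> N" "P' q \<in> N" using ab(4) by (auto simp: N_def q_def)
  hence "map_prod D D q \<bullet> map_prod D D q \<le> \<mu> * Q"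
    using P(5)[of q] T_sq[of "P q"] T_sq[of "P' q"] by (simp add: P(3,4) Q_def)
  moreover have "\<delta> * Q \<le> map_prod D D q \<bullet> map_prod D D q"
    using bounds(2)[OF _ ab(1)] bounds(2)[OF _ ab(2)] \<open>\<delta> > 0\<close>
    by (simp add: q_def Q_def distrib_left)
  ultimately have "\<delta> * Q \<le> \<mu> * Q" by linarith
  with \<open>Q > 0\<close> show ?thesis by (simp add: mult_le_cancel_right)
qed

text \<open>On this side the ordinary Rayleigh quotient works: \<open>\<mu> * R \<le> 2 * (map_prod
  D D q \<bullet> q) \<le> 2 * \<delta> * (q \<bullet> q) \<le> \<delta> * R\<close>.\<close>

lemma symplectic_eigenvalue_ge:
  fixes T :: "'a::{real_inner, complete_space} \<times> 'a \<Rightarrow> 'a \<times> 'a"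
  assumes W: "symplectic M" "T = adjoint M \<circ> map_prod D D \<circ> M"
    and D: "linear D" "\<And>x. D x \<bullet> x \<ge> 0"
    and G: "finite G" "0 \<notin> G" "pairwise orthogonal G" "\<And>e. e \<in> G \<Longrightarrow> \<exists>\<nu>\<le>\<delta>. D e = \<nu> *\<^sub>R e"
    and F: "finite F" "card F < card G" "\<And>x. (\<forall>e\<in>F. x \<bullet> e = 0) \<Longrightarrow> \<mu> * (x \<bullet> x) \<le> T x \<bullet> x"
  shows "\<mu> \<le> \<delta>"
proof -
  obtain P P' where P: "linear P" "linear P'"
    "\<And>q. T (P q) \<bullet> P q = map_prod D D q \<bullet> q" "\<And>q. T (P' q) \<bullet> P' q = map_prod D D q \<bullet> q"
    "\<And>q. 2 * (q \<bullet> q) \<le> P q \<bullet> P q + P' q \<bullet> P' q"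
    using williamson_forms[OF W D(1)] by metis
  obtain a b where ab: "a \<in> span G" "b \<in> span G" "(a, b) \<noteq> 0"
    "\<And>e. e \<in> F \<Longrightarrow> P (a, b) \<bullet> e = 0 \<and> P' (a, b) \<bullet> e = 0"
    using exists_pair_with_orthogonal_images[OF P(1,2) G(1-3) F(1,2)] by blast
  define q where "q = (a, b)"
  define R where "R = P q \<bullet> P q + P' q \<bullet> P' q"
  \<comment> \<open>The last inequality of the chain multiplies the norm estimate by
    \<open>\<delta>\<close>. Its sign comes from some eigenvalue of the positive \<open>D\<close>
    that is at most \<open>\<delta>\<close>.\<close>
  have "\<delta> \<ge> 0"
  proof -
    obtain e where e: "e \<in> G" using F(2) by fastforce
    then obtain \<nu> where "\<nu> \<le> \<delta>" "D e = \<nu> *\<^sub>R e" using G(4) by blast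
    moreover have "e \<bullet> e > 0" using e G(2) by auto
    ultimately show ?thesis using D(2)[of e] by (smt (verit) inner_scaleR_left mult_neg_pos)
  qed
  \<comment> \<open>Passing to \<open>- D\<close> turns the lower bound of
    \<open>eigenvalue_bounds_on_span\<close> into the upper bound required here.\<close>
  have "linear (\<lambda>x. - D x)" using D(1) by (rule linear_compose_neg)
  note bounds = eigenvalue_bounds_on_span(1)[OF this G(1,3), of "- \<delta>"]
  have "\<exists>\<nu>\<ge>- \<delta>. - D e = \<nu> *\<^sub>R e" if "e \<in> G" for e
    using G(4)[OF that] by (metis neg_le_iff_le scaleR_minus_left)
  hence "map_prod D D q \<bullet> q \<le> \<delta> * (q \<bullet> q)"
    using bounds[OF _ ab(1)] bounds[OF _ ab(2)] by (simp add: q_def distrib_left)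
  also have "2 * (\<delta> * (q \<bullet> q)) \<le> \<delta> * R"
    using P(5)[of q] mult_left_mono[OF _ \<open>\<delta> \<ge> 0\<close>, of "2 * (q \<bullet> q)" R] by (simp add: R_def)
  moreover have "\<mu> * R \<le> 2 * (map_prod D D q \<bullet> q)"
    using F(3)[of "P q"] F(3)[of "P' q"] ab(4) by (simp add: R_def P(3,4) q_def distrib_left)
  ultimately have "\<mu> * R \<le> \<delta> * R" by linarith
  moreover have "R > 0" using P(5)[of q] ab(3) by (smt (verit) R_def q_def inner_gt_zero_iff)
  ultimately show ?thesis by (simp add: mult_le_cancel_right)
qed

section \<open>Negation, which exchanges left and right\<close>

lemma eigenvalues_right_uminus:
  assumes "eigenvalues_left A \<alpha> n f"
  shows "eigenvalues_right (\<lambda>x. - A x) (- \<alpha>) n (\<lambda>j. - f j)"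
proof -
  have "eigenspace (\<lambda>x. - A x) (complex_of_real \<mu>) = eigenspace A (complex_of_real (- \<mu>))" for \<mu>
    by (auto simp: eigenspace_def complexify_def cscale_def minus_equation_iff[of _ "_ *\<^sub>R _"])
  hence "eigen_multiplicity (\<lambda>x. - A x) (complex_of_real \<mu>) =
      eigen_multiplicity A (complex_of_real (- \<mu>))" for \<mu>
    by (simp add: eigen_multiplicity_def)
  moreover have "{j \<in> index_set n. - f j = \<mu>} = {j \<in> index_set n. f j = - \<mu>}" for \<mu>
    by auto
  moreover have "\<mu> > - \<alpha> \<longleftrightarrow> - \<mu> < \<alpha>" for \<mu> by auto
  ultimately show ?thesis
    using assms unfolding eigenvalues_left_def eigenvalues_right_def by simp
qed

lemma compact_operator_uminus:
  assumes "compact_operator A"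
  shows "compact_operator (\<lambda>x. - A x)"
proof -
  have "compact (closure ((\<lambda>x. - A x) ` S))" if "bounded S" for S
  proof -
    have cpt: "compact (uminus ` closure (A ` S))"
      using assms that by (intro compact_continuous_image continuous_intros)
        (simp add: compact_operator_def)
    have "closure ((\<lambda>x. - A x) ` S) \<subseteq> uminus ` closure (A ` S)"
    proof (rule closure_minimal)
      show "(\<lambda>x. - A x) ` S \<subseteq> uminus ` closure (A ` S)"
        by (intro image_subsetI imageI subsetD[OF closure_subset])
    qed (rule compact_imp_closed[OF cpt])
    with compact_Int_closed[OF cpt closed_closure] show ?thesis by (metis inf.absorb2)
  qed
  thus ?thesis using assms by (simp add: compact_operator_def bounded_linear_minus)
qed

text \<open>The default \<open>\<alpha>\<close> covers an arrangement with fewer than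
  \<open>j\<close> terms: either way at most the first \<open>j - 1\<close> terms exceed
  \<open>\<mu>\<close>, as \<open>eigenvectors_above\<close> requires.\<close>

lemma eigenvalues_right_threshold:
  assumes ev: "eigenvalues_right A \<alpha> n f" and "1 \<le> j"
  defines "\<mu> \<equiv> if enat j \<le> n then f j else \<alpha>"
  shows "\<alpha> \<le> \<mu>" and "{i \<in> index_set n. f i > \<mu>} \<subseteq> {1..<j}"
proof -
  show "\<alpha> \<le> \<mu>"
    using ev \<open>1 \<le> j\<close> by (auto simp: \<mu>_def eigenvalues_right_def index_set_def less_imp_le)
  show "{i \<in> index_set n. f i > \<mu>} \<subseteq> {1..<j}"
  proof
    fix i assume "i \<in> {i \<in> index_set n. f i > \<mu>}"
    hence i: "i \<in> index_set n" "f i > \<mu>" by auto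
    have "i < j"
    proof (rule ccontr)
      assume "\<not> i < j"
      hence j: "j \<in> index_set n" "j \<le> i" using index_set_downward[OF i(1)] \<open>1 \<le> j\<close> by auto
      have "\<forall>i\<in>index_set n. \<forall>j\<in>index_set n. i \<le> j \<longrightarrow> f i \<ge> f j"
        using ev by (simp add: eigenvalues_right_def)
      hence "f i \<le> f j" using i(1) j by blast
      moreover have "\<mu> = f j" using j by (simp add: \<mu>_def index_set_def)
      ultimately show False using i(2) by simp
    qed
    thus "i \<in> {1..<j}" using i by (simp add: index_set_def)
  qed
qed

section \<open>The two inequalities for the arrangements\<close>

lemma symplectic_eigenvalues_right_le:
  fixes T :: "'a::{real_inner, complete_space} \<times> 'a \<Rightarrow> 'a \<times> 'a"
  assumes T: "positive_operator T" and cpt: "compact_operator (\<lambda>x. T x - \<alpha> *\<^sub>R x)" and "\<alpha> > 0"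
    and lam: "eigenvalues_right T \<alpha> n lam" and d: "symplectic_eigenvalues_right T \<alpha> s d"
    and j: "1 \<le> j" "enat j \<le> s"
  shows "enat j \<le> n \<and> d j \<le> lam j"
proof -
  from d obtain D M where D: "positive_operator D" "eigenvalues_right D \<alpha> s d"
    and W: "symplectic M" "T = adjoint M \<circ> map_prod D D \<circ> M"
    by (auto simp: symplectic_eigenvalues_right_def williamson_form_def)
  have linD: "linear D" using D by (simp add: positive_operator_def bounded_linear.linear)
  have blT: "bounded_linear T" and psd: "\<And>x. T x \<bullet> x \<ge> 0" using T by (auto simp: positive_operator_def)
  have "j \<in> index_set s" using j by (simp add: index_set_def)
  hence dj: "d j > \<alpha>" using D by (simp add: eigenvalues_right_def)
  obtain G where G: "finite G" "j \<le> card G" "0 \<notin> G" "pairwise orthogonal G"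
    "\<And>e. e \<in> G \<Longrightarrow> \<exists>\<nu>\<ge>d j. D e = \<nu> *\<^sub>R e"
    using eigenvectors_of_largest_eigenvalues[OF linD positive_operator_symmetric[OF D(1)] D(2)
        \<open>j \<in> index_set s\<close>] by blast
  define \<mu> where "\<mu> = (if enat j \<le> n then lam j else \<alpha>)"
  have \<mu>: "\<alpha> \<le> \<mu>" "{i \<in> index_set n. lam i > \<mu>} \<subseteq> {1..<j}"
    unfolding \<mu>_def by (rule eigenvalues_right_threshold[OF lam j(1)])+
  obtain F where F: "finite F" "card F < j" "\<And>e. e \<in> F \<Longrightarrow> \<exists>\<nu>. T e = \<nu> *\<^sub>R e"
    "\<And>x. (\<forall>e\<in>F. x \<bullet> e = 0) \<Longrightarrow> T x \<bullet> x \<le> \<mu> * (x \<bullet> x)"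
    using eigenvectors_above[OF blT positive_operator_symmetric[OF T] cpt lam \<mu> j(1)]
    by blast
  have "d j \<le> \<mu>"
    by (rule symplectic_eigenvalue_le[OF W linD bounded_linear.linear[OF blT]
          positive_operator_symmetric[OF T] psd G(1,3,4,5) F(1) _ F(3,4)])
      (use F G dj \<open>\<alpha> > 0\<close> in auto)
  \<comment> \<open>If the \<open>j\<close>-th eigenvalue did not exist, \<open>\<mu>\<close> would
    be \<open>\<alpha>\<close>, contradicting \<open>d j > \<alpha>\<close>. Thus the same bound
    also proves \<open>enat j \<le> n\<close>.\<close>
  with dj show ?thesis by (auto simp: \<mu>_def split: if_splits)
qed

lemma symplectic_eigenvalues_left_ge:
  fixes T :: "'a::{real_inner, complete_space} \<times> 'a \<Rightarrow> 'a \<times> 'a"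
  assumes T: "positive_operator T" and cpt: "compact_operator (\<lambda>x. T x - \<alpha> *\<^sub>R x)"
    and lam: "eigenvalues_left T \<alpha> n lam" and d: "symplectic_eigenvalues_left T \<alpha> s d"
    and j: "1 \<le> j" "enat j \<le> s"
  shows "enat j \<le> n \<and> lam j \<le> d j"
proof -
  from d obtain D M where D: "positive_operator D" "eigenvalues_left D \<alpha> s d"
    and W: "symplectic M" "T = adjoint M \<circ> map_prod D D \<circ> M"
    by (auto simp: symplectic_eigenvalues_left_def williamson_form_def)
  have linD: "linear D" and psd: "\<And>x. D x \<bullet> x \<ge> 0"
    using D by (auto simp: positive_operator_def bounded_linear.linear)
  have blT: "bounded_linear (\<lambda>x. - T x)"
    using T by (simp add: positive_operator_def bounded_linear_minus)
  have "j \<in> index_set s" using j by (simp add: index_set_def)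
  hence dj: "d j < \<alpha>" using D by (simp add: eigenvalues_left_def)
  have "\<exists>G. finite G \<and> j \<le> card G \<and> 0 \<notin> G \<and> pairwise orthogonal G \<and>
      (\<forall>e\<in>G. \<exists>\<nu>\<ge>- d j. - D e = \<nu> *\<^sub>R e)"
    by (rule eigenvectors_of_largest_eigenvalues[OF linear_compose_neg[OF linD] _
          eigenvalues_right_uminus[OF D(2)] \<open>j \<in> index_set s\<close>])
      (simp add: positive_operator_symmetric[OF D(1)])
  then obtain G where G: "finite G" "j \<le> card G" "0 \<notin> G" "pairwise orthogonal G"
    "\<And>e. e \<in> G \<Longrightarrow> \<exists>\<nu>\<ge>- d j. - D e = \<nu> *\<^sub>R e" by blast
  have eigG: "\<exists>\<nu>\<le>d j. D e = \<nu> *\<^sub>R e" if "e \<in> G" for e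
    using G(5)[OF that] by (metis minus_le_iff minus_minus scaleR_minus_left)
  define \<mu> where "\<mu> = (if enat j \<le> n then lam j else \<alpha>)"
  have "- \<mu> = (if enat j \<le> n then - lam j else - \<alpha>)" by (simp add: \<mu>_def)
  hence \<mu>: "- \<alpha> \<le> - \<mu>" "{i \<in> index_set n. - lam i > - \<mu>} \<subseteq> {1..<j}"
    using eigenvalues_right_threshold[OF eigenvalues_right_uminus[OF lam] j(1)] by simp_all
  \<comment> \<open>The spectral results are applied to \<open>- T\<close> with centre
    \<open>- \<alpha>\<close>; the difference is the negative of
    \<open>T - \<alpha>\<close>.\<close>
  have cpt': "compact_operator (\<lambda>x. - T x - (- \<alpha>) *\<^sub>R x)"
    using compact_operator_uminus[OF cpt] by (simp add: algebra_simps)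
  have "\<exists>F. finite F \<and> card F < j \<and> (\<forall>e\<in>F. \<exists>\<nu>. - T e = \<nu> *\<^sub>R e) \<and>
      (\<forall>x. (\<forall>e\<in>F. x \<bullet> e = 0) \<longrightarrow> - T x \<bullet> x \<le> - \<mu> * (x \<bullet> x))"
    by (rule eigenvectors_above[OF blT _ cpt' eigenvalues_right_uminus[OF lam] \<mu> j(1)])
      (simp add: positive_operator_symmetric[OF T])
  then obtain F where F: "finite F" "card F < j"
    "\<And>x. (\<forall>e\<in>F. x \<bullet> e = 0) \<Longrightarrow> \<mu> * (x \<bullet> x) \<le> T x \<bullet> x" by auto
  have "\<mu> \<le> d j"
    by (rule symplectic_eigenvalue_ge[OF W linD psd G(1,3,4) eigG F(1) _ F(3)]) (use F G in auto)
  with dj show ?thesis by (auto simp: \<mu>_def split: if_splits)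
qed

theorem theorem9:
  fixes T :: "'a::{real_inner, complete_space} \<times> 'a \<Rightarrow> 'a \<times> 'a"
    and \<alpha> :: real
    and n\<^sub>R n\<^sub>L s\<^sub>R s\<^sub>L :: enat
    and lamR lamL dR dL :: "nat \<Rightarrow> real"
  assumes "infinite_dimensional (UNIV :: 'a set)"
    and "separable_space (euclidean :: 'a topology)"
    and "positive_operator T"
    and "invertible_operator T"
    and "\<alpha> > 0"
    and "compact_operator (\<lambda>x. T x - \<alpha> *\<^sub>R x)"
    and "eigenvalues_right T \<alpha> n\<^sub>R lamR"
    and "eigenvalues_left T \<alpha> n\<^sub>L lamL"
    and "symplectic_eigenvalues_right T \<alpha> s\<^sub>R dR"
    and "symplectic_eigenvalues_left T \<alpha> s\<^sub>L dL"
  shows "(\<forall>j\<ge>1. enat j \<le> s\<^sub>R \<longrightarrow> enat j \<le> n\<^sub>R \<and> dR j \<le> lamR j) \<and>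
         (\<forall>j\<ge>1. enat j \<le> s\<^sub>L \<longrightarrow> enat j \<le> n\<^sub>L \<and> lamL j \<le> dL j)"
  using symplectic_eigenvalues_right_le[OF assms(3,6,5,7,9)]
    symplectic_eigenvalues_left_ge[OF assms(3,6,8,10)]
  by blast

end
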